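(* Let $q_T$ be the probability density function of the spot price $S_T$ at maturity $T$, with characteristic function $\phi_T(u)=\int_{-\infty}^{\infty}e^{iuS}q_T(S)\,dS$. Let $C_T(K)$ be the price of a call option with strike $K$ and maturity $T$, $$C_T(K)=\int_K^\infty e^{-rT}(S-K)\,q_T(S)\,dS,$$ and for $\alpha>0$ let the modified call price be $c_T(K)=\exp(\alpha K)\,C_T(K)$, with Fourier transform $$\psi_T(v)=\int_{-\infty}^{\infty}e^{ivK}c_T(K)\,dK.$$ Then $$C_T(K)=\frac{\exp(-\alpha K)}{2\pi}\int_{-\infty}^{\infty}e^{-ivK}\psi_T(v)\,dv=\frac{\exp(-\alpha K)}{\pi}\int_0^{\infty}e^{-ivK}\psi_T(v)\,dv,$$ and $$\psi_T(v)=\frac{e^{-rT}}{(\alpha+iv)^2}\,\phi_T(v-i\alpha).$$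
   Context: Here $i$ is the imaginary unit, $r$ is the interest rate, and $S_T$ is the price of the asset at time $T$, which may take any real value. Since $C_T(K)$ is not square-integrable as $K\to-\infty$, it is multiplied by the damping factor $\exp(\alpha K)$, $\alpha>0$, in order to obtain a square-integrable function $c_T$. $\phi_T(v-i\alpha)$ denotes $\phi_T$ evaluated at the complex argument $v-i\alpha$.
   Formalization: The half-line formula is proved with the real part of the integral from 0 to infinity, since that integral is in general not real; integrability of exp(αS)q_T(S), needed for φ_T(v−iα) and ψ_T to exist, is assumed explicitly. *)

theory Defs
  imports "HOL-Probability.Probability"
begin

text \<open>
  Throughout, \<open>q\<close> is the density of the spot price at maturity \<open>T\<close> and \<open>r\<close> is the interest rate.
  The characteristic function is defined on complex arguments, because the pricing formula
  evaluates it off the real axis. Bochner integrals of non-integrable functions are 0, so the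
  integral below is meaningful only where \<open>\<lambda>s. exp (- Im u * s) * q s\<close> is integrable.
\<close>

definition char_fun :: "(real \<Rightarrow> real) \<Rightarrow> complex \<Rightarrow> complex" where
  "char_fun q u = (LINT s|lborel. exp (\<i> * u * of_real s) * of_real (q s))"

definition call_price :: "real \<Rightarrow> real \<Rightarrow> (real \<Rightarrow> real) \<Rightarrow> real \<Rightarrow> real" where
  "call_price r T q K = (LINT s:{K..}|lborel. exp (- r * T) * (s - K) * q s)"

definition modified_call_price ::
  "real \<Rightarrow> real \<Rightarrow> (real \<Rightarrow> real) \<Rightarrow> real \<Rightarrow> real \<Rightarrow> real" where
  "modified_call_price r T q \<alpha> K = exp (\<alpha> * K) * call_price r T q K"

text \<open>
  Since the modified price is real, its transform \<open>\<psi>\<close> satisfies \<open>\<psi> (- v) = cnj (\<psi> v)\<close>.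
  Hence the inversion integral over the half line equals half of the one over the whole line
  only up to an imaginary part, which does not vanish in general: the half-line pricing
  formula has to be read as a statement about real parts.
\<close>

definition call_transform ::
  "real \<Rightarrow> real \<Rightarrow> (real \<Rightarrow> real) \<Rightarrow> real \<Rightarrow> real \<Rightarrow> complex" where
  "call_transform r T q \<alpha> v =
     (LINT K|lborel. exp (\<i> * of_real v * of_real K) * of_real (modified_call_price r T q \<alpha> K))"

end

theory Submission
  imports Defs
begin

text \<open>
  Fubini gives the formula for \<open>\<psi>\<close>, since the transform of the damped payoff
  \<open>max 0 (s - K) * exp (\<alpha> * K)\<close> in \<open>K\<close> is \<open>exp (z * s) / z\<^sup>2\<close> with \<open>z = \<alpha> + \<i> * v\<close>.
  Hence \<open>\<psi>\<close> is \<open>O (1 / (\<alpha>\<^sup>2 + v\<^sup>2))\<close> and therefore integrable. The modified price is integrable,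
  continuous and bounded (because \<open>max 0 x \<le> exp (\<alpha> * x) / \<alpha>\<close>), so pointwise Fourier inversion
  applies; it is obtained by inserting a Gaussian factor into the inversion integral, which turns
  it into a Gaussian average of the function, and letting the width tend to 0.
\<close>

section \<open>Fourier inversion by Gaussian smoothing\<close>

lemma fourier_std_normal_density:
  "(LINT v|lborel. exp (\<i> * of_real (t * v)) * of_real (std_normal_density v))
     = complex_of_real (exp (- t\<^sup>2 / 2))"
proof -
  have "(LINT v|lborel. exp (\<i> * of_real (t * v)) * of_real (std_normal_density v))
      = (LINT v|std_normal_distribution. iexp (t * v))"
    by (subst integral_density) (auto simp: scaleR_conv_of_real mult.commute)
  also have "\<dots> = char std_normal_distribution t"
    by (simp add: char_def)
  finally show ?thesis
    by (simp add: char_std_normal_distribution)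
qed

lemma integrable_std_normal_density_scaled:
  assumes "0 < \<sigma>"
  shows "integrable lborel (\<lambda>v. std_normal_density (\<sigma> * v))"
  using lborel_integrable_real_affine[OF integrable_normal_density[of 1 0], of \<sigma> 0] assms by simp

text \<open>Rescaling the variable by \<sigma> turns the Gaussian in t into one of width \<sigma>.
  It is expressed through \<open>std_normal_density\<close> so that it can serve as the kernel of an
  average.\<close>

lemma fourier_std_normal_density_scaled:
  assumes "0 < \<sigma>"
  shows "(LINT v|lborel. exp (\<i> * of_real (t * v)) * of_real (std_normal_density (\<sigma> * v)))
     = complex_of_real (sqrt (2 * pi) / \<sigma> * std_normal_density (t / \<sigma>))"
proof -
  have "(LINT v|lborel. exp (\<i> * of_real (t / \<sigma> * v)) * of_real (std_normal_density v))
     = \<sigma> *\<^sub>R (LINT v|lborel. exp (\<i> * of_real (t * v)) * of_real (std_normal_density (\<sigma> * v)))"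
    by (subst lborel_integral_real_affine[where c=\<sigma> and t=0]) (use assms in auto)
  then have "(LINT v|lborel. exp (\<i> * of_real (t * v)) * of_real (std_normal_density (\<sigma> * v)))
     = of_real (exp (- (t / \<sigma>)\<^sup>2 / 2) / \<sigma>)"
    unfolding fourier_std_normal_density using assms
    by (simp add: scaleR_conv_of_real field_simps)
  then show ?thesis
    by (simp add: std_normal_density_def)
qed

text \<open>The Gaussian factor makes the double integral in y and v absolutely convergent even if
  the transform of \<open>f\<close> is not integrable. After the exchange the v-integral is a
  Gaussian kernel in y centred at \<open>x\<close>, so the y-integral averages \<open>f\<close>
  around \<open>x\<close>.\<close>

lemma fourier_gaussian_smoothing:
  fixes f :: "real \<Rightarrow> complex"
  assumes f: "integrable lborel f" and \<sigma>: "0 < \<sigma>"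
  shows "(LINT v|lborel. exp (- \<i> * of_real v * of_real x) *
            (LINT y|lborel. exp (\<i> * of_real v * of_real y) * f y) * of_real (std_normal_density (\<sigma> * v)))
       = of_real (sqrt (2 * pi)) * (LINT z|lborel. f (x + \<sigma> * z) * of_real (std_normal_density z))"
proof -
  have [measurable]: "f \<in> borel_measurable borel"
    using borel_measurable_integrable[OF f] by simp
  define g where "g y v = f y * (exp (\<i> * of_real ((y - x) * v)) * of_real (std_normal_density (\<sigma> * v)))"
    for y v
  \<comment> \<open>The norm splits into a function of y times a function of v, so the Fubini
    condition reduces to integrability of \<open>f\<close> and of the scaled density.\<close>
  have norm_g: "norm (g y v) = norm (f y) * std_normal_density (\<sigma> * v)" for y v
    by (simp add: g_def norm_mult norm_exp_i_times del: of_real_mult of_real_diff)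
  have n: "integrable lborel (\<lambda>v. std_normal_density (\<sigma> * v))"
    by (rule integrable_std_normal_density_scaled[OF \<sigma>])
  have g_meas [measurable]: "case_prod g \<in> borel_measurable (lborel \<Otimes>\<^sub>M lborel)"
    unfolding g_def std_normal_density_def by measurable
  have g_int: "integrable (lborel \<Otimes>\<^sub>M lborel) (case_prod g)"
  proof (rule lborel_pair.Fubini_integrable)
    show "integrable lborel (\<lambda>y. LINT v|lborel. norm (case (y, v) of (y, v) \<Rightarrow> g y v))"
      using f by (simp add: norm_g)
    have [measurable]: "g y \<in> borel_measurable borel" for y
      unfolding g_def std_normal_density_def by measurable
    have "integrable lborel (g y)" for y
      by (rule Bochner_Integration.integrable_bound[OF integrable_mult_right[OF n, of "norm (f y)"]])
        (simp_all add: norm_g)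
    then show "AE y in lborel. integrable lborel (\<lambda>v. case (y, v) of (y, v) \<Rightarrow> g y v)"
      by simp
  qed simp
  have "(LINT v|lborel. exp (- \<i> * of_real v * of_real x) *
            (LINT y|lborel. exp (\<i> * of_real v * of_real y) * f y) * of_real (std_normal_density (\<sigma> * v)))
      = (LINT v|lborel. LINT y|lborel. g y v)"
  proof (rule Bochner_Integration.integral_cong[OF refl])
    fix v
    have "g y v = exp (- \<i> * of_real v * of_real x) * of_real (std_normal_density (\<sigma> * v)) *
        (exp (\<i> * of_real v * of_real y) * f y)" for y
      by (simp add: g_def exp_diff exp_minus field_simps)
    then have "(LINT y|lborel. g y v) = exp (- \<i> * of_real v * of_real x) * of_real (std_normal_density (\<sigma> * v)) *
        (LINT y|lborel. exp (\<i> * of_real v * of_real y) * f y)"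
      by simp
    then show "exp (- \<i> * of_real v * of_real x) *
            (LINT y|lborel. exp (\<i> * of_real v * of_real y) * f y) * of_real (std_normal_density (\<sigma> * v))
        = (LINT y|lborel. g y v)"
      by (simp add: mult_ac)
  qed
  also have "\<dots> = (LINT y|lborel. LINT v|lborel. g y v)"
    by (rule lborel_pair.Fubini_integral[OF g_int])
  also have "\<dots> = (LINT y|lborel. f y * of_real (sqrt (2 * pi) / \<sigma> * std_normal_density ((y - x) / \<sigma>)))"
    unfolding g_def
    by (subst integral_mult_right_zero, subst fourier_std_normal_density_scaled[OF \<sigma>], rule refl)
  \<comment> \<open>Substitution y = x + \<sigma> z; the Jacobian \<sigma> cancels the factor 1 /
    \<sigma> at the end.\<close>
  also have "\<dots> = \<sigma> *\<^sub>R (LINT z|lborel. f (x + \<sigma> * z) * of_real (sqrt (2 * pi) / \<sigma> * std_normal_density z))"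
    by (subst lborel_integral_real_affine[where c=\<sigma> and t=x]) (use \<sigma> in auto)
  also have "(LINT z|lborel. f (x + \<sigma> * z) * of_real (sqrt (2 * pi) / \<sigma> * std_normal_density z))
     = (LINT z|lborel. of_real (sqrt (2 * pi) / \<sigma>) * (f (x + \<sigma> * z) * of_real (std_normal_density z)))"
    by (rule Bochner_Integration.integral_cong) simp_all
  finally show ?thesis
    using \<sigma> by (simp add: scaleR_conv_of_real)
qed

text \<open>Both sides of the smoothing identity converge as the width tends to 0. The integrable
  transform dominates the frequency side, \<open>B\<close> times the normal density dominates the
  average, and continuity at \<open>x\<close> identifies the limit of the average.\<close>

theorem fourier_inversion:
  fixes f :: "real \<Rightarrow> complex"
  assumes f: "integrable lborel f" and bounded: "\<And>x. norm (f x) \<le> B" and cont: "isCont f x"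
    and fhat: "integrable lborel (\<lambda>v. LINT y|lborel. exp (\<i> * of_real v * of_real y) * f y)"
  shows "(LINT v|lborel. exp (- \<i> * of_real v * of_real x) *
            (LINT y|lborel. exp (\<i> * of_real v * of_real y) * f y)) = of_real (2 * pi) * f x"
proof -
  have [measurable]: "f \<in> borel_measurable borel"
    using borel_measurable_integrable[OF f] by simp
  define F where "F v = (LINT y|lborel. exp (\<i> * of_real v * of_real y) * f y)" for v
  have F: "integrable lborel F"
    using fhat by (simp add: F_def[abs_def])
  have [measurable]: "F \<in> borel_measurable borel"
    using borel_measurable_integrable[OF F] by simp
  \<comment> \<open>The width runs through 1 / (n + 1), so that sequential dominated convergence
    applies; the shift by one keeps every width positive.\<close>
  define \<sigma> where "\<sigma> n = inverse (real (Suc n))" for n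
  have \<sigma>_pos: "0 < \<sigma> n" for n
    by (simp add: \<sigma>_def)
  have \<sigma>_lim: "\<sigma> \<longlonglongrightarrow> 0"
    unfolding \<sigma>_def by (rule LIMSEQ_inverse_real_of_nat)
  \<comment> \<open>The density peaks at 0, which gives a dominating function independent of the
    width.\<close>
  have n_le: "std_normal_density v \<le> std_normal_density 0" for v
    by (simp add: std_normal_density_def divide_right_mono)
  have "(\<lambda>n. LINT v|lborel. exp (- \<i> * of_real v * of_real x) * F v * of_real (std_normal_density (\<sigma> n * v)))
      \<longlonglongrightarrow> (LINT v|lborel. exp (- \<i> * of_real v * of_real x) * F v * of_real (std_normal_density 0))"
  proof (rule integral_dominated_convergence[where w="\<lambda>v. norm (F v) * std_normal_density 0"])
    show "AE v in lborel. (\<lambda>n. exp (- \<i> * of_real v * of_real x) * F v * of_real (std_normal_density (\<sigma> n * v)))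
      \<longlonglongrightarrow> exp (- \<i> * of_real v * of_real x) * F v * of_real (std_normal_density 0)"
    proof (rule AE_I2)
      fix v
      have "isCont std_normal_density 0"
        unfolding std_normal_density_def[abs_def] by (intro continuous_intros) auto
      moreover have "(\<lambda>n. \<sigma> n * v) \<longlonglongrightarrow> 0"
        by (rule tendsto_mult_left_zero[OF \<sigma>_lim])
      ultimately have "(\<lambda>n. std_normal_density (\<sigma> n * v)) \<longlonglongrightarrow> std_normal_density 0"
        by (rule isCont_tendsto_compose)
      then show "(\<lambda>n. exp (- \<i> * of_real v * of_real x) * F v * of_real (std_normal_density (\<sigma> n * v)))
      \<longlonglongrightarrow> exp (- \<i> * of_real v * of_real x) * F v * of_real (std_normal_density 0)"
        by (intro tendsto_intros)
    qed
    show "AE v in lborel. norm (exp (- \<i> * of_real v * of_real x) * F v * of_real (std_normal_density (\<sigma> n * v)))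
        \<le> norm (F v) * std_normal_density 0" for n
      by (intro AE_I2) (simp add: norm_mult n_le mult_left_mono del: mult_minus_left)
    show "integrable lborel (\<lambda>v. norm (F v) * std_normal_density 0)"
      using F by simp
  qed simp_all
  then have lim1: "(\<lambda>n. LINT v|lborel. exp (- \<i> * of_real v * of_real x) * F v * of_real (std_normal_density (\<sigma> n * v)))
      \<longlonglongrightarrow> (LINT v|lborel. exp (- \<i> * of_real v * of_real x) * F v) * of_real (std_normal_density 0)"
    by simp
  have "(\<lambda>n. LINT z|lborel. f (x + \<sigma> n * z) * of_real (std_normal_density z))
      \<longlonglongrightarrow> (LINT z|lborel. f x * of_real (std_normal_density z))"
  proof (rule integral_dominated_convergence[where w="\<lambda>z. B * std_normal_density z"])
    show "AE z in lborel. (\<lambda>n. f (x + \<sigma> n * z) * of_real (std_normal_density z))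
      \<longlonglongrightarrow> f x * of_real (std_normal_density z)"
    proof (rule AE_I2)
      fix z
      have "(\<lambda>n. x + \<sigma> n * z) \<longlonglongrightarrow> x"
        using tendsto_add[OF tendsto_const tendsto_mult_left_zero[OF \<sigma>_lim]] by simp
      from isCont_tendsto_compose[OF cont this]
      show "(\<lambda>n. f (x + \<sigma> n * z) * of_real (std_normal_density z))
      \<longlonglongrightarrow> f x * of_real (std_normal_density z)"
        by (intro tendsto_intros)
    qed
    show "AE z in lborel. norm (f (x + \<sigma> n * z) * of_real (std_normal_density z)) \<le> B * std_normal_density z" for n
      by (intro AE_I2) (simp add: norm_mult bounded mult_right_mono)
    show "integrable lborel (\<lambda>z. B * std_normal_density z)"
      using integrable_normal_density[of 1 0] by simp
  qed simp_all
  moreover have "(LINT z|lborel. f x * of_real (std_normal_density z)) = f x"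
    using integral_normal_density[of 1 0] by simp
  ultimately have "(\<lambda>n. of_real (sqrt (2 * pi)) * (LINT z|lborel. f (x + \<sigma> n * z) * of_real (std_normal_density z)))
      \<longlonglongrightarrow> of_real (sqrt (2 * pi)) * f x"
    by (intro tendsto_intros) simp
  then have "(\<lambda>n. LINT v|lborel. exp (- \<i> * of_real v * of_real x) * F v * of_real (std_normal_density (\<sigma> n * v)))
      \<longlonglongrightarrow> of_real (sqrt (2 * pi)) * f x"
    unfolding F_def fourier_gaussian_smoothing[OF f \<sigma>_pos] .
  from LIMSEQ_unique[OF lim1 this]
  have "(LINT v|lborel. exp (- \<i> * of_real v * of_real x) * F v) * of_real (std_normal_density 0)
      = of_real (sqrt (2 * pi)) * f x" .
  \<comment> \<open>The peak value of the density is 1 / sqrt (2 pi); moving it to the other side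
    produces the constant 2 pi.\<close>
  then have "(LINT v|lborel. exp (- \<i> * of_real v * of_real x) * F v)
      = of_real (sqrt (2 * pi) * sqrt (2 * pi)) * f x"
    unfolding std_normal_density_def of_real_mult by (simp add: field_simps del: real_sqrt_mult_self)
  then show ?thesis
    unfolding F_def by simp
qed

section \<open>The exponential transform of the call payoff\<close>

text \<open>Integration by parts yields the antiderivative - (t / z + 1 / z^2) exp (- z t), which
  tends to 0 at infinity and equals - 1 / z^2 at 0. Integrability comes first, from the real case
  with exponent Re z, since the norm of exp (- z t) is exp (- Re z t).\<close>

lemma
  fixes z :: complex
  assumes z: "0 < Re z"
  shows integrable_half_line_times_exp: "set_integrable lborel {0..} (\<lambda>t. of_real t * exp (- z * of_real t))"
    and integral_half_line_times_exp: "(LINT t:{0..}|lborel. of_real t * exp (- z * of_real t)) = 1 / z\<^sup>2"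
proof -
  have real: "set_integrable lborel (einterval 0 \<infinity>) (\<lambda>t. t * exp (- Re z * t))"
  proof (rule interval_integral_FTC_nonneg(1))
    show "((\<lambda>t. - (t / Re z + 1 / (Re z)\<^sup>2) * exp (- Re z * t)) has_real_derivative t * exp (- Re z * t)) (at t)" for t
      using z by (auto intro!: derivative_eq_intros) (simp add: field_simps power2_eq_square)
    show "(((\<lambda>t. - (t / Re z + 1 / (Re z)\<^sup>2) * exp (- Re z * t)) \<circ> real_of_ereal) \<longlongrightarrow> - (1 / (Re z)\<^sup>2)) (at_right 0)"
      unfolding zero_ereal_def ereal_tendsto_simps using z by (auto intro!: tendsto_eq_intros)
    show "(((\<lambda>t. - (t / Re z + 1 / (Re z)\<^sup>2) * exp (- Re z * t)) \<circ> real_of_ereal) \<longlongrightarrow> 0) (at_left \<infinity>)"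
      unfolding ereal_tendsto_simps using z by real_asymp
  qed (auto intro!: continuous_intros)
  have E: "einterval 0 \<infinity> = {0::real<..}"
    by (auto simp: einterval_def)
  have int: "set_integrable lborel {0<..} (\<lambda>t. of_real t * exp (- z * of_real t))"
    unfolding set_integrable_def
    by (rule Bochner_Integration.integrable_bound[OF real[unfolded set_integrable_def E]])
      (auto simp: norm_mult norm_exp_eq_Re indicator_def)
  have lim0: "((\<lambda>t. t * exp (- Re z * t)) \<longlongrightarrow> 0) at_top" "((\<lambda>t. exp (- Re z * t)) \<longlongrightarrow> 0) at_top"
    using z by real_asymp+
  have "(LBINT t=0..\<infinity>. of_real t * exp (- z * of_real t)) = 0 - (- (1 / z\<^sup>2))"
  proof (rule interval_integral_FTC_integrable)
    show "((\<lambda>t. - (of_real t / z + 1 / z\<^sup>2) * exp (- z * of_real t)) has_vector_derivative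
        of_real t * exp (- z * of_real t)) (at t)" for t :: real
    proof -
      have "((\<lambda>t. - (t / z + 1 / z\<^sup>2) * exp (- z * t)) has_field_derivative
        of_real t * exp (- z * of_real t)) (at (of_real t))"
        using z by (auto intro!: derivative_eq_intros simp: field_simps power2_eq_square)
      then show ?thesis
        by (rule has_vector_derivative_real_field)
    qed
    show "(((\<lambda>t. - (of_real t / z + 1 / z\<^sup>2) * exp (- z * of_real t)) \<circ> real_of_ereal) \<longlongrightarrow> - (1 / z\<^sup>2)) (at_right 0)"
      unfolding zero_ereal_def ereal_tendsto_simps using z by (auto intro!: tendsto_eq_intros)
    have "((\<lambda>t. of_real t * exp (- z * of_real t)) \<longlongrightarrow> 0) at_top"
      by (rule Lim_null_comparison[OF _ lim0(1)]) (auto simp: norm_mult norm_exp_eq_Re eventually_at_top_linorder intro!: exI[of _ 0])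
    moreover have "((\<lambda>t. exp (- z * of_real t)) \<longlongrightarrow> 0) at_top"
      by (rule Lim_null_comparison[OF _ lim0(2)]) (auto simp: norm_exp_eq_Re)
    ultimately have "((\<lambda>t. - 1 / z * (of_real t * exp (- z * of_real t)) - 1 / z\<^sup>2 * exp (- z * of_real t))
        \<longlongrightarrow> - 1 / z * 0 - 1 / z\<^sup>2 * 0) at_top"
      by (intro tendsto_intros)
    then show "(((\<lambda>t. - (of_real t / z + 1 / z\<^sup>2) * exp (- z * of_real t)) \<circ> real_of_ereal) \<longlongrightarrow> 0) (at_left \<infinity>)"
      unfolding ereal_tendsto_simps by (simp add: algebra_simps)
  qed (use int E in \<open>auto intro!: continuous_intros\<close>)
  then have val: "(LINT t:{0<..}|lborel. of_real t * exp (- z * of_real t)) = 1 / z\<^sup>2"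
    by (simp add: interval_lebesgue_integral_0_infty)
  \<comment> \<open>The closed and the open half line give the same integrand because it vanishes at
    t = 0.\<close>
  have "(\<lambda>t. indicat_real {0..} t *\<^sub>R (of_real t * exp (- z * of_real t))) =
      (\<lambda>t. indicat_real {0<..} t *\<^sub>R (of_real t * exp (- z * of_real t)))"
    by (auto simp: indicator_def)
  with int val show "set_integrable lborel {0..} (\<lambda>t. of_real t * exp (- z * of_real t))"
    "(LINT t:{0..}|lborel. of_real t * exp (- z * of_real t)) = 1 / z\<^sup>2"
    unfolding set_integrable_def set_lebesgue_integral_def by simp_all
qed

text \<open>The payoff vanishes for K > s, and K = s - t maps the rest to the half line, with exp (z
  s) as a constant factor.\<close>

lemma has_bochner_integral_call_payoff_exp:
  fixes z :: complex and s :: real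
  assumes z: "0 < Re z"
  shows "has_bochner_integral lborel (\<lambda>K. of_real (max 0 (s - K)) * exp (z * of_real K)) (exp (z * of_real s) / z\<^sup>2)"
proof -
  \<comment> \<open>The shapes \<open>s + - 1 * t\<close> and, below,
    \<open>/\<^sub>R \<bar>- 1\<bar>\<close> match the affine change of variables with slope -1,
    whose Jacobian is 1.\<close>
  have eq: "(\<lambda>t. of_real (max 0 (s - (s + - 1 * t))) * exp (z * of_real (s + - 1 * t)))
      = (\<lambda>t. exp (z * of_real s) * (indicat_real {0..} t *\<^sub>R (of_real t * exp (- z * of_real t))))"
    by (auto simp: indicator_def max_def exp_diff exp_minus field_simps)
  have "has_bochner_integral lborel (\<lambda>t. indicat_real {0..} t *\<^sub>R (of_real t * exp (- z * of_real t))) (1 / z\<^sup>2)"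
    using integrable_half_line_times_exp[OF z] integral_half_line_times_exp[OF z]
    by (simp add: has_bochner_integral_iff set_integrable_def set_lebesgue_integral_def)
  from has_bochner_integral_mult_right[OF this, of "exp (z * of_real s)"]
  have "has_bochner_integral lborel
      (\<lambda>t. exp (z * of_real s) * (indicat_real {0..} t *\<^sub>R (of_real t * exp (- z * of_real t))))
      ((exp (z * of_real s) / z\<^sup>2) /\<^sub>R \<bar>- 1\<bar>)"
    by simp
  then show ?thesis
    unfolding eq[symmetric] by (rule lborel_has_bochner_integral_real_affine_iff[THEN iffD2, rotated]) simp
qed

text \<open>The real part of the complex formula at a real exponent. It evaluates the integral of
  norms in the Fubini argument for the call transform.\<close>

lemma has_bochner_integral_call_payoff_exp_real:
  fixes a s :: real
  assumes "0 < a"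
  shows "has_bochner_integral lborel (\<lambda>K. max 0 (s - K) * exp (a * K)) (exp (a * s) / a\<^sup>2)"
proof -
  have "has_bochner_integral lborel (\<lambda>K. complex_of_real (max 0 (s - K) * exp (a * K))) (of_real (exp (a * s) / a\<^sup>2))"
    using has_bochner_integral_call_payoff_exp[of "of_real a" s] assms by (simp add: exp_of_real[symmetric])
  from has_bochner_integral_bounded_linear[OF bounded_linear_Re this] show ?thesis
    by (simp only: Re_complex_of_real)
qed

section \<open>Payoff bound, half-line integrals and quadratic decay\<close>

text \<open>This is y \<le> exp y at y = a x, together with positivity of exp. With x = s - K the
  factor exp (- a K) will cancel the damping.\<close>

lemma max_0_le_exp:
  fixes a x :: real
  assumes "0 < a"
  shows "max 0 x \<le> exp (a * x) / a"
proof -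
  have "a * x \<le> exp (a * x)"
    using exp_ge_add_one_self[of "a * x"] by linarith
  then show ?thesis
    using assms by (simp add: field_simps max_def)
qed

text \<open>Using the positive part moves the strike from the domain of integration into an
  integrand that is continuous in K.\<close>

lemma call_price_eq: "call_price r T q K = exp (- r * T) * (LINT s|lborel. max 0 (s - K) * q s)"
proof -
  have "(\<lambda>s. indicat_real {K..} s *\<^sub>R (exp (- r * T) * (s - K) * q s)) =
      (\<lambda>s. exp (- r * T) * (max 0 (s - K) * q s))"
    by (auto simp: indicator_def max_def)
  then show ?thesis
    unfolding call_price_def set_lebesgue_integral_def by simp
qed

text \<open>Reflection in the origin turns the integral over the negative half line into the
  conjugate of the one over the positive half line, so their sum is twice a real part.\<close>

lemma Re_integral_half_line_hermitian:
  fixes h :: "real \<Rightarrow> complex"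
  assumes h: "integrable lborel h" and herm: "\<And>v. h (- v) = cnj (h v)"
  shows "2 * Re (LINT v:{0..}|lborel. h v) = Re (LINT v|lborel. h v)"
proof -
  have [measurable]: "h \<in> borel_measurable borel"
    using borel_measurable_integrable[OF h] by simp
  have int: "integrable lborel (\<lambda>v. indicat_real A v *\<^sub>R h v)" if "A \<in> sets borel" for A
    using integrable_mult_indicator[of A lborel h] h that by simp
  have "(LINT v|lborel. indicat_real {..0} v *\<^sub>R h v) = (LINT v|lborel. indicat_real {..0} (0 + - 1 * v) *\<^sub>R h (0 + - 1 * v))"
    by (subst lborel_integral_real_affine[where c="-1" and t=0]) simp_all
  also have "\<dots> = (LINT v|lborel. cnj (indicat_real {0..} v *\<^sub>R h v))"
    by (rule Bochner_Integration.integral_cong) (simp_all add: herm indicator_def)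
  also have "\<dots> = cnj (LINT v|lborel. indicat_real {0..} v *\<^sub>R h v)"
    by (rule Bochner_Integration.integral_cnj)
  finally have neg: "(LINT v|lborel. indicat_real {..0} v *\<^sub>R h v) = cnj (LINT v|lborel. indicat_real {0..} v *\<^sub>R h v)" .
  have "(LINT v|lborel. h v) = (LINT v|lborel. indicat_real {0..} v *\<^sub>R h v + indicat_real {..0} v *\<^sub>R h v)"
  proof (rule integral_cong_AE)
    \<comment> \<open>The two closed half lines overlap in 0, so the splitting fails at most on a
      null set.\<close>
    show "AE v in lborel. h v = indicat_real {0..} v *\<^sub>R h v + indicat_real {..0} v *\<^sub>R h v"
      using AE_lborel_singleton[of 0] by eventually_elim (auto simp: indicator_def)
  qed simp_all
  also have "\<dots> = (LINT v|lborel. indicat_real {0..} v *\<^sub>R h v) + (LINT v|lborel. indicat_real {..0} v *\<^sub>R h v)"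
    by (rule Bochner_Integration.integral_add) (simp_all add: int)
  finally show ?thesis
    unfolding neg set_lebesgue_integral_def by simp
qed

text \<open>Rescaling of 1 / (1 + x^2) by x = v / a. The function is the majorant of the call
  transform.\<close>

lemma integrable_inverse_sum_squares:
  fixes a :: real
  assumes "0 < a"
  shows "integrable lborel (\<lambda>v. 1 / (a\<^sup>2 + v\<^sup>2))"
proof -
  have "integrable lborel (\<lambda>x::real. inverse (1 + x\<^sup>2))"
    using integrable_inverse_1_plus_square by (simp add: set_integrable_def)
  from lborel_integrable_real_affine[OF this, of "1 / a" 0] assms
  have "integrable lborel (\<lambda>v. 1 / a\<^sup>2 * inverse (1 + (v / a)\<^sup>2))"
    by simp
  also have "(\<lambda>v. 1 / a\<^sup>2 * inverse (1 + (v / a)\<^sup>2)) = (\<lambda>v. 1 / (a\<^sup>2 + v\<^sup>2))"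
  proof
    fix v
    have "a\<^sup>2 * (1 + (v / a)\<^sup>2) = a\<^sup>2 + v\<^sup>2"
      using assms by (simp add: field_simps)
    then show "1 / a\<^sup>2 * inverse (1 + (v / a)\<^sup>2) = 1 / (a\<^sup>2 + v\<^sup>2)"
      by (metis inverse_eq_divide inverse_mult_distrib)
  qed
  finally show ?thesis .
qed

section \<open>Boundedness and continuity of the damped call price\<close>

text \<open>The condition \<open>exp_moment\<close> is the absolute convergence of
  \<open>char_fun q\<close> at v - \<i> \<alpha> for every real v, since the exponential there has
  norm exp (\<alpha> s).\<close>

locale damped_density =
  fixes q :: "real \<Rightarrow> real" and \<alpha> :: real
  assumes measurable_density [measurable]: "q \<in> borel_measurable borel"
    and nonneg: "0 \<le> q s"
    and damping_pos: "0 < \<alpha>"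
    and exp_moment: "integrable lborel (\<lambda>s. exp (\<alpha> * s) * q s)"
begin

text \<open>The majorant is free of K. It therefore serves for integrability at each strike, for the
  uniform bound on the modified price and for its continuity.\<close>

lemma call_payoff_bound:
  "exp (\<alpha> * K) * (max 0 (s - K) * q s) \<le> exp (\<alpha> * s) * q s / \<alpha>"
proof -
  have "exp (\<alpha> * K) * max 0 (s - K) \<le> exp (\<alpha> * K) * (exp (\<alpha> * (s - K)) / \<alpha>)"
    by (rule mult_left_mono[OF max_0_le_exp[OF damping_pos]]) simp
  also have "\<dots> = exp (\<alpha> * s) / \<alpha>"
    by (simp add: right_diff_distrib exp_diff)
  finally show ?thesis
    using mult_right_mono[OF _ nonneg[of s]] by (fastforce simp: mult_ac)
qed

lemma integrable_damped_call_payoff: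
  "integrable lborel (\<lambda>s. exp (\<alpha> * K) * (max 0 (s - K) * q s))"
  by (rule Bochner_Integration.integrable_bound[OF integrable_divide[OF exp_moment, of \<alpha>]])
    (use call_payoff_bound[of K] damping_pos in \<open>auto simp: nonneg abs_mult\<close>)

text \<open>At a fixed strike the discounted payoff is a constant multiple of the damped one. Hence
  \<open>call_price\<close> is a genuine integral and not the default value 0.\<close>

lemma set_integrable_call_payoff:
  "set_integrable lborel {K..} (\<lambda>s. exp (- r * T) * (s - K) * q s)"
proof -
  have eq: "(\<lambda>s. indicat_real {K..} s *\<^sub>R (exp (- r * T) * (s - K) * q s)) =
      (\<lambda>s. exp (- r * T) * exp (- \<alpha> * K) * (exp (\<alpha> * K) * (max 0 (s - K) * q s)))"
    by (auto simp: indicator_def max_def exp_minus)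
  show ?thesis
    unfolding set_integrable_def eq by (rule integrable_mult_right[OF integrable_damped_call_payoff])
qed

lemma modified_call_price_eq:
  "modified_call_price r T q \<alpha> K = exp (- r * T) * (LINT s|lborel. exp (\<alpha> * K) * (max 0 (s - K) * q s))"
  by (simp add: modified_call_price_def call_price_eq)

lemma measurable_modified_call_price [measurable]:
  "modified_call_price r T q \<alpha> \<in> borel_measurable borel"
  unfolding modified_call_price_eq[abs_def] by measurable

text \<open>Integrating the payoff bound gives a constant free of K; the complex norm fits the
  boundedness hypothesis of \<open>fourier_inversion\<close>.\<close>

lemma norm_modified_call_price_le:
  "norm (complex_of_real (modified_call_price r T q \<alpha> K))
     \<le> exp (- r * T) * (LINT s|lborel. exp (\<alpha> * s) * q s / \<alpha>)"
proof -
  have "0 \<le> (LINT s|lborel. exp (\<alpha> * K) * (max 0 (s - K) * q s))"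
    by (rule Bochner_Integration.integral_nonneg) (simp add: nonneg)
  moreover have "(LINT s|lborel. exp (\<alpha> * K) * (max 0 (s - K) * q s)) \<le> (LINT s|lborel. exp (\<alpha> * s) * q s / \<alpha>)"
    by (rule integral_mono[OF integrable_damped_call_payoff integrable_divide[OF exp_moment] call_payoff_bound])
  ultimately show ?thesis
    by (simp only: norm_of_real modified_call_price_eq abs_mult abs_exp_cancel abs_of_nonneg)
      (rule mult_left_mono, simp_all)
qed

text \<open>Dominated convergence along an arbitrary sequence of strikes, with the majorant that is
  free of the strike.\<close>

lemma isCont_modified_call_price: "isCont (modified_call_price r T q \<alpha>) K"
proof (rule continuous_at_sequentiallyI)
  fix X :: "nat \<Rightarrow> real"
  assume X: "X \<longlonglongrightarrow> K"
  have "(\<lambda>n. LINT s|lborel. exp (\<alpha> * X n) * (max 0 (s - X n) * q s))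
     \<longlonglongrightarrow> (LINT s|lborel. exp (\<alpha> * K) * (max 0 (s - K) * q s))"
  proof (rule integral_dominated_convergence[where w="\<lambda>s. exp (\<alpha> * s) * q s / \<alpha>"])
    show "AE s in lborel. (\<lambda>n. exp (\<alpha> * X n) * (max 0 (s - X n) * q s))
       \<longlonglongrightarrow> exp (\<alpha> * K) * (max 0 (s - K) * q s)"
      by (intro AE_I2 tendsto_intros X)
    show "AE s in lborel. norm (exp (\<alpha> * X n) * (max 0 (s - X n) * q s)) \<le> exp (\<alpha> * s) * q s / \<alpha>" for n
      using call_payoff_bound[of "X n"] by (simp add: abs_mult nonneg)
  qed (use exp_moment in simp_all)
  then show "(\<lambda>n. modified_call_price r T q \<alpha> (X n)) \<longlonglongrightarrow> modified_call_price r T q \<alpha> K"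
    unfolding modified_call_price_eq by (intro tendsto_intros)
qed

section \<open>The transform of the damped price and its inversion\<close>

text \<open>One Fubini argument yields both claims: integrating in K first gives exp (z s) / z^2 for
  z = \<alpha> + \<i> v, and the remaining s-integral is the characteristic function.\<close>

lemma
  shows integrable_modified_call_price_exp: "complex_integrable lborel
      (\<lambda>K. exp (\<i> * of_real v * of_real K) * of_real (modified_call_price r T q \<alpha> K))"
    and call_transform_eq: "call_transform r T q \<alpha> v =
      of_real (exp (- r * T)) / (of_real \<alpha> + \<i> * of_real v)\<^sup>2 * char_fun q (of_real v - \<i> * of_real \<alpha>)"
proof -
  define z where "z = of_real \<alpha> + \<i> * of_real v"
  have Re_z: "Re z = \<alpha>"
    by (simp add: z_def)
  \<comment> \<open>The factor exp (z K) merges the damping exp (\<alpha> K) with the Fourier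
    kernel.\<close>
  define g where "g s K = of_real (q s) * (of_real (max 0 (s - K)) * exp (z * of_real K))" for s K
  have norm_g: "norm (g s K) = q s * (max 0 (s - K) * exp (\<alpha> * K))" for s K
    by (simp add: g_def norm_mult nonneg norm_exp_eq_Re Re_z)
  have g_meas [measurable]: "case_prod g \<in> borel_measurable (lborel \<Otimes>\<^sub>M lborel)"
    unfolding g_def by measurable
  have z_pos: "0 < Re z"
    using damping_pos Re_z by simp
  note payoff = has_bochner_integral_call_payoff_exp[OF z_pos]
  note payoff_real = has_bochner_integral_call_payoff_exp_real[OF damping_pos]
  have g_int: "integrable (lborel \<Otimes>\<^sub>M lborel) (case_prod g)"
  proof (rule lborel_pair.Fubini_integrable)
    \<comment> \<open>The integral of norms over K is a multiple of exp (\<alpha> s) q s, so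
      \<open>exp_moment\<close> is exactly what Fubini requires.\<close>
    have "(LINT K|lborel. norm (g s K)) = exp (\<alpha> * s) * q s / \<alpha>\<^sup>2" for s
      unfolding norm_g by (simp add: has_bochner_integral_integral_eq[OF payoff_real])
    then show "integrable lborel (\<lambda>s. LINT K|lborel. norm (case (s, K) of (s, K) \<Rightarrow> g s K))"
      using exp_moment by simp
    have "integrable lborel (g s)" for s
      unfolding g_def by (intro integrable_mult_right integrable.intros[OF payoff])
    then show "AE s in lborel. integrable lborel (\<lambda>K. case (s, K) of (s, K) \<Rightarrow> g s K)"
      by simp
  qed simp
  have g_eq: "exp (\<i> * of_real v * of_real K) * of_real (modified_call_price r T q \<alpha> K)
      = of_real (exp (- r * T)) * (LINT s|lborel. g s K)" for K
  proof -
    have "g s K = exp (\<i> * of_real v * of_real K) * of_real (exp (\<alpha> * K) * (max 0 (s - K) * q s))" for s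
      by (simp add: g_def z_def distrib_right exp_add exp_of_real[symmetric])
    then have "(LINT s|lborel. g s K) = exp (\<i> * of_real v * of_real K) *
        of_real (LINT s|lborel. exp (\<alpha> * K) * (max 0 (s - K) * q s))"
      by (simp only: integral_mult_right_zero integral_complex_of_real)
    then show ?thesis
      by (simp add: modified_call_price_eq)
  qed
  \<comment> \<open>Up to the discount factor the integrand is the s-integral of \<open>g\<close>,
    which Fubini makes integrable in K.\<close>
  show "complex_integrable lborel
      (\<lambda>K. exp (\<i> * of_real v * of_real K) * of_real (modified_call_price r T q \<alpha> K))"
    unfolding g_eq by (intro integrable_mult_right lborel_pair.integrable_snd g_int)
  have "call_transform r T q \<alpha> v = of_real (exp (- r * T)) * (LINT K|lborel. LINT s|lborel. g s K)"
    unfolding call_transform_def g_eq by simp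
  also have "(LINT K|lborel. LINT s|lborel. g s K) = (LINT s|lborel. LINT K|lborel. g s K)"
    by (rule lborel_pair.Fubini_integral[OF g_int])
  also have "\<dots> = (LINT s|lborel. 1 / z\<^sup>2 * (exp (z * of_real s) * of_real (q s)))"
    unfolding g_def integral_mult_right_zero has_bochner_integral_integral_eq[OF payoff] by (simp add: mult_ac)
  also have "\<dots> = 1 / z\<^sup>2 * (LINT s|lborel. exp (z * of_real s) * of_real (q s))"
    by (rule integral_mult_right_zero)
  \<comment> \<open>The complex argument arises from \<i> (v - \<i> \<alpha>) = \<alpha> + \<i> v =
    z.\<close>
  also have "(LINT s|lborel. exp (z * of_real s) * of_real (q s)) = char_fun q (of_real v - \<i> * of_real \<alpha>)"
    by (simp add: char_fun_def z_def algebra_simps)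
  finally show "call_transform r T q \<alpha> v =
      of_real (exp (- r * T)) / (of_real \<alpha> + \<i> * of_real v)\<^sup>2 * char_fun q (of_real v - \<i> * of_real \<alpha>)"
    by (simp add: z_def)
qed

text \<open>The characteristic function at v - \<i> \<alpha> is bounded by the exponential moment,
  uniformly in v; the decay comes from the squared denominator, of norm \<alpha>^2 + v^2.\<close>

lemma norm_call_transform_le:
  "norm (call_transform r T q \<alpha> v)
     \<le> exp (- r * T) * (LINT s|lborel. exp (\<alpha> * s) * q s) * (1 / (\<alpha>\<^sup>2 + v\<^sup>2))"
proof -
  have "norm (char_fun q (of_real v - \<i> * of_real \<alpha>))
      \<le> (LINT s|lborel. norm (exp (\<i> * (of_real v - \<i> * of_real \<alpha>) * of_real s) * of_real (q s)))"
    unfolding char_fun_def by (rule integral_norm_bound)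
  also have "\<dots> = (LINT s|lborel. exp (\<alpha> * s) * q s)"
    by (simp add: norm_mult norm_exp_eq_Re nonneg)
  finally have "norm (char_fun q (of_real v - \<i> * of_real \<alpha>)) \<le> (LINT s|lborel. exp (\<alpha> * s) * q s)" .
  moreover have "norm ((of_real \<alpha> + \<i> * of_real v)\<^sup>2) = \<alpha>\<^sup>2 + v\<^sup>2"
    by (simp add: norm_power cmod_power2)
  ultimately show ?thesis
    unfolding call_transform_eq by (simp add: norm_mult norm_divide mult_left_mono divide_right_mono)
qed

lemma integrable_call_transform: "complex_integrable lborel (call_transform r T q \<alpha>)"
proof (rule Bochner_Integration.integrable_bound)
  show "integrable lborel (\<lambda>v. exp (- r * T) * (LINT s|lborel. exp (\<alpha> * s) * q s) * (1 / (\<alpha>\<^sup>2 + v\<^sup>2)))"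
    by (intro integrable_mult_right integrable_inverse_sum_squares damping_pos)
  show "call_transform r T q \<alpha> \<in> borel_measurable lborel"
    unfolding call_transform_def[abs_def] by measurable
  show "AE v in lborel. norm (call_transform r T q \<alpha> v)
      \<le> norm (exp (- r * T) * (LINT s|lborel. exp (\<alpha> * s) * q s) * (1 / (\<alpha>\<^sup>2 + v\<^sup>2)))"
    by (intro AE_I2 order_trans[OF norm_call_transform_le]) (simp only: real_norm_def abs_ge_self)
qed

lemma integrable_exp_call_transform:
  "complex_integrable lborel (\<lambda>v. exp (- \<i> * of_real v * of_real K) * call_transform r T q \<alpha> v)"
proof (rule Bochner_Integration.integrable_bound[OF integrable_call_transform[of r T]])
  have [measurable]: "call_transform r T q \<alpha> \<in> borel_measurable borel"
    using borel_measurable_integrable[OF integrable_call_transform] by simp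
  show "(\<lambda>v. exp (- \<i> * of_real v * of_real K) * call_transform r T q \<alpha> v) \<in> borel_measurable lborel"
    by measurable
qed (simp add: norm_mult)

lemma call_transform_inversion:
  "(LINT v|lborel. exp (- \<i> * of_real v * of_real K) * call_transform r T q \<alpha> v)
     = of_real (2 * pi * modified_call_price r T q \<alpha> K)"
proof -
  \<comment> \<open>At v = 0 the Fourier kernel is 1, which leaves integrability of the modified
    price itself.\<close>
  have "complex_integrable lborel (\<lambda>K. of_real (modified_call_price r T q \<alpha> K))"
    using integrable_modified_call_price_exp[of 0] by simp
  from fourier_inversion[OF this norm_modified_call_price_le, of K]
    isCont_of_real[OF isCont_modified_call_price]
    integrable_call_transform[of r T]
  show ?thesis
    by (simp add: call_transform_def[abs_def] isCont_modified_call_price)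
qed

lemma call_transform_uminus: "call_transform r T q \<alpha> (- v) = cnj (call_transform r T q \<alpha> v)"
  unfolding call_transform_def Bochner_Integration.integral_cnj[symmetric] by (simp add: exp_cnj)

text \<open>The factor exp (- \<i> v K) preserves the Hermitian symmetry of the transform, so the
  half-line integral has half the whole-line value 2 pi c as its real part, where c is the modified
  price.\<close>

lemma call_transform_half_line_inversion:
  "Re (LINT v:{0..}|lborel. exp (- \<i> * of_real v * of_real K) * call_transform r T q \<alpha> v)
     = pi * modified_call_price r T q \<alpha> K"
proof -
  have "2 * Re (LINT v:{0..}|lborel. exp (- \<i> * of_real v * of_real K) * call_transform r T q \<alpha> v)
     = Re (LINT v|lborel. exp (- \<i> * of_real v * of_real K) * call_transform r T q \<alpha> v)"
    by (rule Re_integral_half_line_hermitian[OF integrable_exp_call_transform])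
      (simp add: call_transform_uminus exp_cnj)
  then show ?thesis
    unfolding call_transform_inversion by simp
qed

lemma call_price_eq_modified: "call_price r T q K = exp (- \<alpha> * K) * modified_call_price r T q \<alpha> K"
  by (simp add: modified_call_price_def exp_minus)

end

text \<open>The integrability clauses certify that the integrals converge and do not take the
  default value 0; the half-line integral inherits this from the whole line by restriction.\<close>

theorem mainTheorem2:
  fixes M :: "'a measure" and S\<^sub>T :: "'a \<Rightarrow> real" and q :: "real \<Rightarrow> real" and r T \<alpha> :: real
  assumes "prob_space M"
    and density: "distributed M lborel S\<^sub>T (\<lambda>s. ennreal (q s))"
    and density_nonneg: "\<And>s. 0 \<le> q s"
    and damping: "0 < \<alpha>"
    and exp_moment: "integrable lborel (\<lambda>s. exp (\<alpha> * s) * q s)"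
  shows
    "(\<forall>K. set_integrable lborel {K..} (\<lambda>s. exp (- r * T) * (s - K) * q s)) \<and>
     (\<forall>v. complex_integrable lborel
          (\<lambda>K. exp (\<i> * of_real v * of_real K) * of_real (modified_call_price r T q \<alpha> K))) \<and>
     (\<forall>K. complex_integrable lborel
          (\<lambda>v. exp (- \<i> * of_real v * of_real K) * call_transform r T q \<alpha> v)) \<and>
     (\<forall>K. complex_of_real (call_price r T q K) =
          of_real (exp (- \<alpha> * K) / (2 * pi)) *
          (LINT v|lborel. exp (- \<i> * of_real v * of_real K) * call_transform r T q \<alpha> v)) \<and>
     (\<forall>K. call_price r T q K =
          exp (- \<alpha> * K) / pi *
          Re (LINT v:{0..}|lborel. exp (- \<i> * of_real v * of_real K) * call_transform r T q \<alpha> v)) \<and>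
     (\<forall>v. call_transform r T q \<alpha> v =
          of_real (exp (- r * T)) / (of_real \<alpha> + \<i> * of_real v)\<^sup>2 *
          char_fun q (of_real v - \<i> * of_real \<alpha>))"
proof -
  \<comment> \<open>A density in the sense of \<open>distributed\<close> is extended nonnegative;
    measurability passes back to the real function by \<open>enn2real\<close>, as \<open>q\<close>
    is nonnegative.\<close>
  have "(\<lambda>s. ennreal (q s)) \<in> borel_measurable lborel"
    using density by (rule distributed_borel_measurable)
  then have "(\<lambda>s. enn2real (ennreal (q s))) \<in> borel_measurable lborel"
    by measurable
  then have "q \<in> borel_measurable borel"
    by (simp add: density_nonneg)
  then interpret damped_density q \<alpha>
    using density_nonneg damping exp_moment by unfold_locales
  show ?thesis
    unfolding call_transform_inversion call_transform_half_line_inversion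
    by (intro conjI allI set_integrable_call_payoff integrable_modified_call_price_exp
        integrable_exp_call_transform call_transform_eq)
      (simp_all add: call_price_eq_modified)
qed

end
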